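(* Let $K$ be a field and let ${\bf n}=(n_1,n_2,n_3,n_4)$ be a sequence of positive integers with $\gcd(n_1,n_2,n_3,n_4)=1$. For each $i$ let $a_i$ be the least positive integer such that $a_i n_i\in\sum_{j\neq i}\mathbb{N}n_j$. Let $I({\bf n})$ be a complete intersection ideal generated by the binomials $f_1=x_1^{a_1}-x_2^{a_2}$, $f_2=x_3^{a_3}-x_1^{u_1}x_2^{u_2}$ and $f_3=x_4^{a_4}-x_1^{v_1}x_2^{v_2}x_3^{v_3}$, where $u_1,u_2,v_1,v_2,v_3\in\mathbb{N}$. Consider the vector ${\bf d}=(0,\,0,\,a_4(a_1+a_2),\,v_3(a_1+a_2)+a_3(a_1+a_2))$. Then there exists a non-negative integer $w_1$ such that for all integers $w\ge w_1$, the ideal $I({\bf n}+w{\bf d})_*$ is a complete intersection whenever the entries of ${\bf n}+w{\bf d}$ are relatively prime.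
   Context: $\mathbb{N}$ is the set of non-negative integers. For a sequence ${\bf m}=(m_1,\ldots,m_4)$ of positive integers with $\gcd(m_1,\ldots,m_4)=1$, the toric ideal $I({\bf m})$ is the kernel of the $K$-algebra homomorphism $K[x_1,\ldots,x_4]\to K[t]$, $x_i\mapsto t^{m_i}$; it has height $3$. For a nonzero polynomial $f$, $f_*$ denotes the homogeneous summand of $f$ of least degree, and $I({\bf m})_*$ is the ideal generated by all $f_*$ with $f\in I({\bf m})$, $f\neq 0$; it also has height $3$. Each of the ideals $I({\bf m})$, $I({\bf m})_*$ is a complete intersection if it can be generated by $3$ elements. "The entries are relatively prime" means that the greatest common divisor of all four entries is $1$. *)

theory Defs
  imports
    "HOL-Library.Poly_Mapping"
    "HOL-Library.Numeral_Type"
    "HOL-Computational_Algebra.Polynomial"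
begin

text \<open>
  The variables \<open>x\<^sub>1, \<dots>, x\<^sub>4\<close> are indexed by the four-element type \<^typ>\<open>4\<close>, whose elements are
  \<open>1, 2, 3, 4\<close> (arithmetic is modulo 4, so \<open>4 = 0\<close>). A monomial is its exponent vector, and a
  polynomial is a finitely supported map from monomials to coefficients, with the convolution
  product of \<^theory>\<open>HOL-Library.Poly_Mapping\<close>.
\<close>

type_synonym monomial4 = "4 \<Rightarrow>\<^sub>0 nat"
type_synonym 'k poly4 = "monomial4 \<Rightarrow>\<^sub>0 'k"

definition X :: "4 \<Rightarrow> 'k::field poly4"
  where "X i = Poly_Mapping.single (Poly_Mapping.single i 1) 1"

definition ideal_generated_by :: "'a::comm_ring_1 set \<Rightarrow> 'a set"
  where "ideal_generated_by S = module.span (*) S"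

definition toric_map :: "(4 \<Rightarrow> nat) \<Rightarrow> 'k::field poly4 \<Rightarrow> 'k poly"
  where "toric_map m f =
    (\<Sum>\<alpha>\<in>Poly_Mapping.keys f.
      smult (Poly_Mapping.lookup f \<alpha>) (\<Prod>i\<in>UNIV. monom 1 (m i) ^ Poly_Mapping.lookup \<alpha> i))"

definition toric_ideal :: "(4 \<Rightarrow> nat) \<Rightarrow> 'k::field poly4 set"
  where "toric_ideal m = {f. toric_map m f = 0}"

definition total_degree :: "monomial4 \<Rightarrow> nat"
  where "total_degree \<alpha> = (\<Sum>i\<in>UNIV. Poly_Mapping.lookup \<alpha> i)"

definition homogeneous_summand :: "nat \<Rightarrow> 'k::field poly4 \<Rightarrow> 'k poly4"
  where "homogeneous_summand e f =
    (\<Sum>\<alpha>\<in>{\<alpha>\<in>Poly_Mapping.keys f. total_degree \<alpha> = e}.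
      Poly_Mapping.single \<alpha> (Poly_Mapping.lookup f \<alpha>))"

text \<open>The value at \<open>f = 0\<close> is irrelevant.\<close>

definition initial_form :: "'k::field poly4 \<Rightarrow> 'k poly4"
  where "initial_form f = homogeneous_summand (LEAST e. homogeneous_summand e f \<noteq> 0) f"

definition initial_ideal :: "'k::field poly4 set \<Rightarrow> 'k poly4 set"
  where "initial_ideal I = ideal_generated_by {initial_form f |f. f \<in> I \<and> f \<noteq> 0}"

text \<open>
  Complete intersection for ideals of height 3, as are \<open>toric_ideal m\<close> and
  \<open>initial_ideal (toric_ideal m)\<close> for positive, relatively prime \<open>m\<close>. The three generators
  need not be distinct.
\<close>

definition complete_intersection3 :: "'k::field poly4 set \<Rightarrow> bool"
  where "complete_intersection3 I \<longleftrightarrow> (\<exists>g\<^sub>1 g\<^sub>2 g\<^sub>3. I = ideal_generated_by {g\<^sub>1, g\<^sub>2, g\<^sub>3})"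

text \<open>The least positive \<open>a\<close> with \<open>a * n i\<close> in the additive monoid generated by the other entries.\<close>

definition least_multiple :: "(4 \<Rightarrow> nat) \<Rightarrow> 4 \<Rightarrow> nat"
  where "least_multiple n i =
    (LEAST a. a > 0 \<and> (\<exists>c :: 4 \<Rightarrow> nat. a * n i = (\<Sum>j\<in>UNIV - {i}. c j * n j)))"


subsection \<open>\<open>toric_map m\<close> is the algebra homomorphism sending \<open>X i\<close> to \<open>t\<close> to the power \<open>m i\<close>\<close>

lemma module_times: "module ((*) :: 'a::comm_ring_1 \<Rightarrow> 'a \<Rightarrow> 'a)"
  by (unfold_locales) (simp_all add: algebra_simps)

lemma toric_map_superset:
  assumes "finite A" "Poly_Mapping.keys f \<subseteq> A"
  shows "toric_map m f = (\<Sum>\<alpha>\<in>A.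
    smult (Poly_Mapping.lookup f \<alpha>) (\<Prod>i\<in>UNIV. monom 1 (m i) ^ Poly_Mapping.lookup \<alpha> i))"
  unfolding toric_map_def using assms
  by (intro sum.mono_neutral_left) (auto simp: in_keys_iff)

lemma toric_map_add: "toric_map m (f + g) = toric_map m f + toric_map m g"
proof -
  let ?A = "Poly_Mapping.keys f \<union> Poly_Mapping.keys g"
  have "Poly_Mapping.keys (f + g) \<subseteq> ?A" by (rule Poly_Mapping.keys_add)
  then show ?thesis
    by (simp add: toric_map_superset[where A = ?A] lookup_add smult_add_left sum.distrib)
qed

lemma toric_map_zero: "toric_map m 0 = 0"
  by (simp add: toric_map_def)

lemma toric_map_sum: "toric_map m (sum f A) = (\<Sum>x\<in>A. toric_map m (f x))"
  by (induction A rule: infinite_finite_induct) (simp_all add: toric_map_zero toric_map_add)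

lemma toric_map_single:
  "toric_map m (Poly_Mapping.single \<alpha> c) =
    smult c (\<Prod>i\<in>UNIV. monom 1 (m i) ^ Poly_Mapping.lookup \<alpha> i)"
  by (subst toric_map_superset[where A = "{\<alpha>}"]) simp_all

lemma poly_mapping_sum_single:
  "(\<Sum>\<alpha>\<in>Poly_Mapping.keys f. Poly_Mapping.single \<alpha> (Poly_Mapping.lookup f \<alpha>)) = f"
  by (rule poly_mapping_eqI)
    (auto simp: lookup_sum lookup_single when_def sum.delta in_keys_iff)

lemma toric_map_mult: "toric_map m (f * g) = toric_map m f * toric_map m g"
proof -
  have single: "toric_map m (Poly_Mapping.single \<alpha> c * Poly_Mapping.single \<beta> d) =
      toric_map m (Poly_Mapping.single \<alpha> c) * toric_map m (Poly_Mapping.single \<beta> d)" for \<alpha> \<beta> c d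
    by (simp add: mult_single toric_map_single lookup_add power_add prod.distrib mult.commute)
  let ?s = "\<lambda>f \<alpha>. Poly_Mapping.single \<alpha> (Poly_Mapping.lookup f \<alpha>)"
  have "toric_map m (sum (?s f) (Poly_Mapping.keys f) * sum (?s g) (Poly_Mapping.keys g)) =
      toric_map m (sum (?s f) (Poly_Mapping.keys f)) * toric_map m (sum (?s g) (Poly_Mapping.keys g))"
    by (simp add: sum_product toric_map_sum single)
  then show ?thesis by (simp only: poly_mapping_sum_single)
qed

lemma toric_map_const: "toric_map m (Poly_Mapping.single 0 c) = [:c:]"
  by (simp add: toric_map_single)

lemma toric_map_X: "toric_map m (X i) = monom 1 (m i)"
proof -
  have "(\<Prod>j\<in>UNIV. monom (1::'a) (m j) ^ (1 when i = j)) = (\<Prod>j\<in>UNIV. if i = j then monom 1 (m j) else 1)"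
    by (intro prod.cong) (auto simp: when_def)
  also have "\<dots> = monom 1 (m i)" by simp
  finally show ?thesis by (simp add: X_def toric_map_single lookup_single)
qed

end

theory Submission
  imports Defs
begin

text \<open>
  The exponents of \<open>f\<^sub>1, f\<^sub>2, f\<^sub>3\<close> form a triangular basis of the lattice orthogonal to \<open>n\<close>, and \<open>n\<close> is
  the vector of its maximal minors. Replacing \<open>u\<^sub>1, u\<^sub>2, v\<^sub>1, v\<^sub>2\<close> by \<open>u\<^sub>1 + w, u\<^sub>2 + w, v\<^sub>1 + w, v\<^sub>2 + w\<close>
  changes the minors exactly to \<open>n + w d\<close>, and if these are relatively prime, the new basis again
  spans the whole orthogonal lattice. For large \<open>w\<close> the initial forms of the last two new binomials
  are \<open>x\<^sub>3\<close> and \<open>x\<^sub>4\<close> to the powers \<open>a\<^sub>3\<close> and \<open>a\<^sub>4\<close>. A monomial outside the ideal \<open>J\<close> of the three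
  initial forms has largest total degree among the monomials of equal weight, and any other of the
  same degree and weight is congruent to it modulo \<open>J\<close>; so \<open>J\<close> is the initial ideal.
\<close>

text \<open>The four numerals are distinct in the type \<open>4\<close>, where \<open>4\<close>
  denotes the residue 0, so they exhaust it by cardinality.\<close>

lemma UNIV_4: "(UNIV :: 4 set) = {1, 2, 3, 4}"
proof -
  have "{1, 2, 3, 4} = (UNIV :: 4 set)"
    by (rule card_seteq) simp_all
  then show ?thesis by (rule sym)
qed
lemma sum_UNIV_4: "(\<Sum>i\<in>(UNIV :: 4 set). f i) = f 1 + f 2 + f 3 + f 4"
  unfolding UNIV_4 by (simp add: add.assoc)

subsection \<open>Ideals, toric ideals and initial forms\<close>

lemma ideal_base: "s \<in> S \<Longrightarrow> s \<in> ideal_generated_by S"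
  unfolding ideal_generated_by_def by (rule module.span_base[OF module_times])

lemma ideal_zero: "0 \<in> ideal_generated_by S"
  unfolding ideal_generated_by_def by (rule module.span_zero[OF module_times])

lemma ideal_mult: "f \<in> ideal_generated_by S \<Longrightarrow> h * f \<in> ideal_generated_by S"
  unfolding ideal_generated_by_def by (rule module.span_scale[OF module_times])

lemma ideal_minus: "f \<in> ideal_generated_by S \<Longrightarrow> - f \<in> ideal_generated_by S"
  unfolding ideal_generated_by_def by (rule module.span_neg[OF module_times])

lemma ideal_sum: "(\<And>x. x \<in> A \<Longrightarrow> f x \<in> ideal_generated_by S) \<Longrightarrow> sum f A \<in> ideal_generated_by S"
  unfolding ideal_generated_by_def by (rule module.span_sum[OF module_times])

lemma ideal_subset: "S \<subseteq> ideal_generated_by T \<Longrightarrow> ideal_generated_by S \<subseteq> ideal_generated_by T"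
  unfolding ideal_generated_by_def
  by (rule module.span_minimal[OF module_times]) (auto intro: module.subspace_span[OF module_times])

section \<open>Coefficient sums over classes of monomials, and the toric ideal\<close>

definition weight :: "(4 \<Rightarrow> nat) \<Rightarrow> monomial4 \<Rightarrow> nat"
  where "weight m \<alpha> = (\<Sum>i\<in>UNIV. Poly_Mapping.lookup \<alpha> i * m i)"

text \<open>Linear functionals that test membership: on weight classes they cut out a toric ideal,
  on lattice classes they vanish on a binomial ideal.\<close>

definition class_sum :: "monomial4 set \<Rightarrow> 'k::field poly4 \<Rightarrow> 'k"
  where "class_sum C f = (\<Sum>\<alpha>\<in>Poly_Mapping.keys f \<inter> C. Poly_Mapping.lookup f \<alpha>)"

lemma class_sum_superset:
  assumes "finite A" "Poly_Mapping.keys f \<subseteq> A"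
  shows "class_sum C f = (\<Sum>\<alpha>\<in>A \<inter> C. Poly_Mapping.lookup f \<alpha>)"
  unfolding class_sum_def using assms
  by (intro sum.mono_neutral_left) (auto simp: in_keys_iff)

lemma class_sum_add: "class_sum C (f + g) = class_sum C f + class_sum C g"
proof -
  let ?A = "Poly_Mapping.keys f \<union> Poly_Mapping.keys g"
  have "Poly_Mapping.keys (f + g) \<subseteq> ?A" by (rule keys_add)
  then show ?thesis
    by (simp add: class_sum_superset[where A = ?A] lookup_add sum.distrib)
qed

lemma class_sum_zero: "class_sum C 0 = 0"
  by (simp add: class_sum_def)

lemma class_sum_uminus: "class_sum C (- f) = - class_sum C f"
  using class_sum_add[of C f "- f"] by (simp add: class_sum_zero eq_neg_iff_add_eq_0 add.commute)

lemma class_sum_diff: "class_sum C (f - g) = class_sum C f - class_sum C g"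
  using class_sum_add[of C f "- g"] by (simp add: class_sum_uminus)

lemma class_sum_sum: "class_sum C (sum f A) = (\<Sum>x\<in>A. class_sum C (f x))"
  by (induction A rule: infinite_finite_induct) (simp_all add: class_sum_zero class_sum_add)

lemma class_sum_single: "class_sum C (Poly_Mapping.single \<alpha> c) = (if \<alpha> \<in> C then c else 0)"
  by (subst class_sum_superset[where A = "{\<alpha>}"]) simp_all

text \<open>A term times a generator still has its two monomials congruent, so a class contains
  both, and their coefficients cancel, or neither.\<close>

lemma class_sum_ideal:
  fixes f :: "'k::field poly4"
  assumes sym: "\<And>\<alpha> \<beta>. E \<alpha> \<beta> \<Longrightarrow> E \<beta> \<alpha>"
    and trans: "\<And>\<alpha> \<beta> \<gamma>. E \<alpha> \<beta> \<Longrightarrow> E \<beta> \<gamma> \<Longrightarrow> E \<alpha> \<gamma>"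
    and shift: "\<And>\<alpha> \<beta> \<gamma>. E \<alpha> \<beta> \<Longrightarrow> E (\<gamma> + \<alpha>) (\<gamma> + \<beta>)"
    and S: "\<And>s. s \<in> S \<Longrightarrow> \<exists>\<alpha> \<beta>. E \<alpha> \<beta> \<and> s = Poly_Mapping.single \<alpha> 1 - Poly_Mapping.single \<beta> 1"
    and f: "f \<in> ideal_generated_by S"
  shows "class_sum {\<beta>. E \<alpha> \<beta>} f = 0"
proof -
  \<comment> \<open>Quantifying over all multiples makes the set of such \<open>f\<close> an ideal,
    as the span induction requires.\<close>
  have "\<forall>h. class_sum {\<beta>. E \<alpha> \<beta>} (h * f) = 0"
    using f unfolding ideal_generated_by_def
  proof (induction rule: module.span_induct[OF module_times, consumes 1, case_names base step])
    case base
    show ?case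
    proof (rule module.subspaceI[OF module_times])
      fix c x :: "'k poly4"
      assume "x \<in> {x. \<forall>h. class_sum {\<beta>. E \<alpha> \<beta>} (h * x) = 0}"
      then show "c * x \<in> {x. \<forall>h. class_sum {\<beta>. E \<alpha> \<beta>} (h * x) = 0}"
        by (simp flip: mult.assoc)
    qed (auto simp: class_sum_zero class_sum_add distrib_left)
  next
    case (step s)
    then obtain \<beta> \<gamma> where E: "E \<beta> \<gamma>"
      and s: "s = Poly_Mapping.single \<beta> 1 - Poly_Mapping.single \<gamma> 1"
      using S by blast
    have single: "class_sum {\<beta>. E \<alpha> \<beta>} (Poly_Mapping.single \<delta> c * s) = 0" for \<delta> c
    proof -
      have "E \<alpha> (\<delta> + \<beta>) \<longleftrightarrow> E \<alpha> (\<delta> + \<gamma>)"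
        using shift[OF E, of \<delta>] sym trans by blast
      then show ?thesis
        by (simp add: s right_diff_distrib mult_single class_sum_diff class_sum_single)
    qed
    show ?case
    proof
      fix h :: "'k poly4"
      have "class_sum {\<beta>. E \<alpha> \<beta>}
        ((\<Sum>\<delta>\<in>Poly_Mapping.keys h. Poly_Mapping.single \<delta> (Poly_Mapping.lookup h \<delta>)) * s) = 0"
        by (simp add: sum_distrib_right class_sum_sum single)
      then show "class_sum {\<beta>. E \<alpha> \<beta>} (h * s) = 0"
        by (simp only: poly_mapping_sum_single)
    qed
  qed
  then have "class_sum {\<beta>. E \<alpha> \<beta>} (1 * f) = 0" by blast
  then show ?thesis by simp
qed

lemma prod_monom_eq: "(\<Prod>i\<in>A. monom (1::'k::field) (m i) ^ e i) = monom 1 (\<Sum>i\<in>A. e i * m i)"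
  by (induction A rule: infinite_finite_induct)
     (simp_all add: monom_power mult_monom mult.commute)

text \<open>A monomial \<alpha> is sent to t to the power \<open>weight m \<alpha>\<close>, so only
  terms of weight \<open>N\<close> contribute. Hence the toric ideal is the common kernel of the
  weight class sums.\<close>

lemma coeff_toric_map: "coeff (toric_map m f) N = class_sum {\<alpha>. weight m \<alpha> = N} f"
proof -
  have "coeff (toric_map m f) N = (\<Sum>\<alpha>\<in>Poly_Mapping.keys f. if weight m \<alpha> = N then Poly_Mapping.lookup f \<alpha> else 0)"
    unfolding toric_map_def
    by (simp add: prod_monom_eq coeff_sum weight_def)
       (intro sum.cong, auto)
  also have "\<dots> = class_sum {\<alpha>. weight m \<alpha> = N} f"
    unfolding class_sum_def by (simp add: sum.inter_restrict)
  finally show ?thesis .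
qed

lemma class_sum_toric_ideal: "f \<in> toric_ideal m \<Longrightarrow> class_sum {\<alpha>. weight m \<alpha> = N} f = 0"
  by (simp add: toric_ideal_def flip: coeff_toric_map)

text \<open>Reads a linear relation between the entries of \<open>m\<close> off a binomial, and
  conversely. If the weights differed, the sum over the weight class of \<alpha> would be 1.\<close>

lemma binomial_in_toric_ideal:
  "Poly_Mapping.single \<alpha> 1 - Poly_Mapping.single \<beta> 1 \<in> (toric_ideal m :: 'k::field poly4 set)
    \<longleftrightarrow> weight m \<alpha> = weight m \<beta>"
proof
  assume "Poly_Mapping.single \<alpha> 1 - Poly_Mapping.single \<beta> 1 \<in> (toric_ideal m :: 'k poly4 set)"
  then have "class_sum {\<gamma>. weight m \<gamma> = weight m \<alpha>}
    (Poly_Mapping.single \<alpha> 1 - Poly_Mapping.single \<beta> 1 :: 'k poly4) = 0"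
    by (rule class_sum_toric_ideal)
  then show "weight m \<alpha> = weight m \<beta>"
    by (simp add: class_sum_diff class_sum_single split: if_splits)
next
  assume "weight m \<alpha> = weight m \<beta>"
  then have "toric_map m (Poly_Mapping.single \<alpha> 1 - Poly_Mapping.single \<beta> 1 :: 'k poly4) = 0"
    by (intro poly_eqI) (simp add: coeff_toric_map class_sum_diff class_sum_single)
  then show "Poly_Mapping.single \<alpha> 1 - Poly_Mapping.single \<beta> 1 \<in> (toric_ideal m :: 'k poly4 set)"
    by (simp add: toric_ideal_def)
qed

section \<open>Homogeneous summands and initial forms\<close>

lemma lookup_homogeneous_summand:
  "Poly_Mapping.lookup (homogeneous_summand e f) \<alpha> = (if total_degree \<alpha> = e then Poly_Mapping.lookup f \<alpha> else 0)"
  unfolding homogeneous_summand_def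
  by (auto simp: lookup_sum lookup_single when_def in_keys_iff)

lemma homogeneous_summand_nonzero_iff:
  "homogeneous_summand e f \<noteq> 0 \<longleftrightarrow> (\<exists>\<alpha>\<in>Poly_Mapping.keys f. total_degree \<alpha> = e)"
  by (auto simp: poly_mapping_eq_iff fun_eq_iff lookup_homogeneous_summand in_keys_iff)

text \<open>Any term of lowest degree decides the \<open>LEAST\<close> in the definition.\<close>

lemma initial_form_eq:
  assumes "\<alpha> \<in> Poly_Mapping.keys f" "\<And>\<beta>. \<beta> \<in> Poly_Mapping.keys f \<Longrightarrow> total_degree \<alpha> \<le> total_degree \<beta>"
  shows "initial_form f = homogeneous_summand (total_degree \<alpha>) f"
proof -
  have "(LEAST e. homogeneous_summand e f \<noteq> 0) = total_degree \<alpha>"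
    using assms by (intro Least_equality) (auto simp: homogeneous_summand_nonzero_iff)
  then show ?thesis by (simp add: initial_form_def)
qed

lemma initial_form_binomial:
  fixes \<alpha> \<beta> :: monomial4
  assumes "\<alpha> \<noteq> \<beta>"
  defines "f \<equiv> Poly_Mapping.single \<alpha> 1 - Poly_Mapping.single \<beta> (1::'k::field)"
  shows "total_degree \<alpha> < total_degree \<beta> \<Longrightarrow> initial_form f = Poly_Mapping.single \<alpha> 1"
    and "total_degree \<alpha> = total_degree \<beta> \<Longrightarrow> initial_form f = f"
    and "total_degree \<alpha> > total_degree \<beta> \<Longrightarrow> initial_form f = - Poly_Mapping.single \<beta> 1"
proof -
  have ks: "Poly_Mapping.keys f = {\<alpha>, \<beta>}"
    using assms(1) by (auto simp: f_def in_keys_iff lookup_minus lookup_single when_def split: if_splits)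
  have look: "Poly_Mapping.lookup f \<gamma> = (if \<gamma> = \<alpha> then 1 else if \<gamma> = \<beta> then - 1 else 0)" for \<gamma>
    using assms(1) by (auto simp: f_def lookup_minus lookup_single when_def)
  show "total_degree \<alpha> < total_degree \<beta> \<Longrightarrow> initial_form f = Poly_Mapping.single \<alpha> 1"
    by (subst initial_form_eq[of \<alpha>], simp add: ks, force simp: ks, rule poly_mapping_eqI)
      (auto simp: lookup_homogeneous_summand look lookup_single when_def)
  show "total_degree \<alpha> = total_degree \<beta> \<Longrightarrow> initial_form f = f"
    by (subst initial_form_eq[of \<alpha>], simp add: ks, force simp: ks, rule poly_mapping_eqI)
      (auto simp: lookup_homogeneous_summand look)
  show "total_degree \<alpha> > total_degree \<beta> \<Longrightarrow> initial_form f = - Poly_Mapping.single \<beta> 1"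
    by (subst initial_form_eq[of \<beta>], simp add: ks, force simp: ks, rule poly_mapping_eqI)
      (auto simp: lookup_homogeneous_summand look lookup_single when_def)
qed

text \<open>A monomial outside \<open>J\<close> is of largest total degree among the monomials of its weight, so the terms
  of lowest degree of \<open>f\<close> of that weight already have coefficient sum zero.\<close>

lemma initial_form_in_ideal:
  fixes f :: "'k::field poly4" and S :: "'k poly4 set"
  defines "J \<equiv> ideal_generated_by S"
  assumes std: "\<And>\<alpha> \<beta>. Poly_Mapping.single \<beta> 1 \<notin> J \<Longrightarrow> weight m \<alpha> = weight m \<beta> \<Longrightarrow>
      total_degree \<alpha> < total_degree \<beta> \<or>
      total_degree \<alpha> = total_degree \<beta> \<and> Poly_Mapping.single \<alpha> 1 - Poly_Mapping.single \<beta> 1 \<in> J"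
    and f: "f \<in> toric_ideal m" "f \<noteq> 0"
  shows "initial_form f \<in> J"
proof -
  let ?x = "\<lambda>\<alpha>. Poly_Mapping.single \<alpha> (1::'k)"
  \<comment> \<open>Coefficients are written as constant polynomials, so that closure of the ideal
    under multiplication absorbs them.\<close>
  have const: "Poly_Mapping.single (\<alpha> :: monomial4) c = Poly_Mapping.single 0 c * ?x \<alpha>" for \<alpha> c
    by (simp add: mult_single)
  define e where "e = Min (total_degree ` Poly_Mapping.keys f)"
  have ne: "Poly_Mapping.keys f \<noteq> {}" using f by simp
  then obtain \<alpha>0 where \<alpha>0: "\<alpha>0 \<in> Poly_Mapping.keys f" "total_degree \<alpha>0 = e"
    unfolding e_def using Min_in[of "total_degree ` Poly_Mapping.keys f"] by fastforce
  have min: "e \<le> total_degree \<beta>" if "\<beta> \<in> Poly_Mapping.keys f" for \<beta>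
    unfolding e_def using that by simp
  let ?A = "{\<alpha> \<in> Poly_Mapping.keys f. total_degree \<alpha> = e}"
  have "initial_form f = (\<Sum>\<alpha>\<in>?A. Poly_Mapping.single \<alpha> (Poly_Mapping.lookup f \<alpha>))"
    using initial_form_eq[of \<alpha>0 f] \<alpha>0 min by (simp add: homogeneous_summand_def)
  \<comment> \<open>The terms of lowest degree are grouped by weight; each group lies in
    \<open>J\<close> separately.\<close>
  also have "\<dots> = (\<Sum>N\<in>weight m ` ?A. \<Sum>\<alpha>\<in>{\<alpha> \<in> ?A. weight m \<alpha> = N}.
      Poly_Mapping.single \<alpha> (Poly_Mapping.lookup f \<alpha>))"
    by (rule sum.image_gen) simp
  also have "\<dots> \<in> J"
    unfolding J_def
  proof (rule ideal_sum, fold J_def)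
    fix N
    let ?B = "{\<alpha> \<in> ?A. weight m \<alpha> = N}"
    show "(\<Sum>\<alpha>\<in>?B. Poly_Mapping.single \<alpha> (Poly_Mapping.lookup f \<alpha>)) \<in> J"
    proof (cases "\<forall>\<alpha>\<in>?B. ?x \<alpha> \<in> J")
      case True
      show ?thesis
        unfolding J_def
      proof (rule ideal_sum, fold J_def)
        fix \<alpha> assume "\<alpha> \<in> ?B"
        then show "Poly_Mapping.single \<alpha> (Poly_Mapping.lookup f \<alpha>) \<in> J"
          using True by (subst const) (simp add: J_def ideal_mult)
      qed
    next
      case False
      then obtain \<beta> where \<beta>: "\<beta> \<in> ?B" "?x \<beta> \<notin> J" by blast
      \<comment> \<open>By \<open>std\<close>, no monomial of weight \<open>N\<close> exceeds the
        degree of \<beta>, which is the least degree \<open>e\<close> in \<open>f\<close>; so every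
        term of \<open>f\<close> of weight \<open>N\<close> has degree \<open>e\<close>.\<close>
      have B: "?B = Poly_Mapping.keys f \<inter> {\<alpha>. weight m \<alpha> = N}"
      proof
        show "Poly_Mapping.keys f \<inter> {\<alpha>. weight m \<alpha> = N} \<subseteq> ?B"
        proof
          fix \<alpha> assume \<alpha>: "\<alpha> \<in> Poly_Mapping.keys f \<inter> {\<alpha>. weight m \<alpha> = N}"
          then have "total_degree \<alpha> \<le> total_degree \<beta>"
            using std[OF \<beta>(2), of \<alpha>] \<beta>(1) by simp linarith
          then show "\<alpha> \<in> ?B" using \<alpha> \<beta>(1) min[of \<alpha>] by simp
        qed
      qed blast
      have "(\<Sum>\<alpha>\<in>?B. Poly_Mapping.lookup f \<alpha>) = 0"
        using class_sum_toric_ideal[OF f(1), of N] unfolding B class_sum_def .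
      moreover have "(\<Sum>\<alpha>\<in>?B. Poly_Mapping.single 0 (Poly_Mapping.lookup f \<alpha>)) =
          Poly_Mapping.single (0 :: monomial4) (\<Sum>\<alpha>\<in>?B. Poly_Mapping.lookup f \<alpha>)"
        by (rule poly_mapping_eqI) (simp add: lookup_sum lookup_single when_def)
      ultimately have "(\<Sum>\<alpha>\<in>?B. Poly_Mapping.single (0 :: monomial4) (Poly_Mapping.lookup f \<alpha>)) = 0"
        by simp
      then have "(\<Sum>\<alpha>\<in>?B. Poly_Mapping.single 0 (Poly_Mapping.lookup f \<alpha>)) * ?x \<beta> = 0"
        by simp
      \<comment> \<open>Because the coefficients sum to zero, \<beta> can be subtracted from every
        monomial of the group, which leaves binomials in \<open>J\<close>.\<close>
      then have "(\<Sum>\<alpha>\<in>?B. Poly_Mapping.single \<alpha> (Poly_Mapping.lookup f \<alpha>)) =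
          (\<Sum>\<alpha>\<in>?B. Poly_Mapping.single 0 (Poly_Mapping.lookup f \<alpha>) * (?x \<alpha> - ?x \<beta>))"
        by (simp add: sum_distrib_right right_diff_distrib sum_subtractf flip: const)
      also have "\<dots> \<in> J"
        unfolding J_def
      proof (rule ideal_sum, rule ideal_mult, fold J_def)
        fix \<alpha> assume "\<alpha> \<in> ?B"
        then show "?x \<alpha> - ?x \<beta> \<in> J"
          using std[OF \<beta>(2), of \<alpha>] \<beta>(1) by simp
      qed
      finally show ?thesis .
    qed
  qed
  finally show ?thesis .
qed

section \<open>Exponent vectors in four variables; monomials and binomials in ideals\<close>

lemma X_power: "X i ^ k = (Poly_Mapping.single (Poly_Mapping.single i k) 1 :: 'k::field poly4)"
proof (induction k)
  case (Suc k)
  have "Poly_Mapping.single i (Suc k) = Poly_Mapping.single i 1 + Poly_Mapping.single i k"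
    using single_add[of i 1 k] by simp
  with Suc show ?case by (simp add: X_def mult_single)
qed simp

lemma weight_4:
  "weight m \<alpha> = Poly_Mapping.lookup \<alpha> 1 * m 1 + Poly_Mapping.lookup \<alpha> 2 * m 2 +
    Poly_Mapping.lookup \<alpha> 3 * m 3 + Poly_Mapping.lookup \<alpha> 4 * m 4"
  by (simp add: weight_def sum_UNIV_4)

lemma total_degree_4:
  "total_degree \<alpha> = Poly_Mapping.lookup \<alpha> 1 + Poly_Mapping.lookup \<alpha> 2 +
    Poly_Mapping.lookup \<alpha> 3 + Poly_Mapping.lookup \<alpha> 4"
  by (simp add: total_degree_def sum_UNIV_4)

lemma monomial4_eqI:
  fixes \<alpha> \<beta> :: monomial4
  assumes "Poly_Mapping.lookup \<alpha> 1 = Poly_Mapping.lookup \<beta> 1"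
    "Poly_Mapping.lookup \<alpha> 2 = Poly_Mapping.lookup \<beta> 2"
    "Poly_Mapping.lookup \<alpha> 3 = Poly_Mapping.lookup \<beta> 3"
    "Poly_Mapping.lookup \<alpha> 4 = Poly_Mapping.lookup \<beta> 4"
  shows "\<alpha> = \<beta>"
proof (rule poly_mapping_eqI)
  fix i :: 4
  have "i \<in> {1, 2, 3, 4}" using UNIV_4 by blast
  then show "Poly_Mapping.lookup \<alpha> i = Poly_Mapping.lookup \<beta> i"
    using assms by auto
qed

lemma monomial_in_ideal:
  assumes J: "X i ^ k \<in> ideal_generated_by S" and le: "k \<le> Poly_Mapping.lookup \<alpha> i"
  shows "Poly_Mapping.single \<alpha> (1::'k::field) \<in> ideal_generated_by S"
proof -
  have "\<alpha> = (\<alpha> - Poly_Mapping.single i k) + Poly_Mapping.single i k"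
    using le by (intro poly_mapping_eqI) (auto simp: lookup_add lookup_minus lookup_single when_def)
  then have "Poly_Mapping.single \<alpha> (1::'k) = Poly_Mapping.single (\<alpha> - Poly_Mapping.single i k) 1 * X i ^ k"
    by (simp add: X_power mult_single)
  then show ?thesis using ideal_mult[OF J] by simp
qed

text \<open>\<open>X 1 ^ (k * c) - X 2 ^ (k * c)\<close> is a multiple of
  \<open>X 1 ^ k - X 2 ^ k\<close> by the geometric sum; \<alpha> and \<beta> share the cofactor
  \<gamma>.\<close>

lemma binomial_in_ideal:
  assumes J: "X 1 ^ k - X 2 ^ k \<in> ideal_generated_by S"
    and "Poly_Mapping.lookup \<alpha> 1 = Poly_Mapping.lookup \<beta> 1 + k * c"
    and "Poly_Mapping.lookup \<beta> 2 = Poly_Mapping.lookup \<alpha> 2 + k * c"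
    and "Poly_Mapping.lookup \<alpha> 3 = Poly_Mapping.lookup \<beta> 3"
    and "Poly_Mapping.lookup \<alpha> 4 = Poly_Mapping.lookup \<beta> 4"
  shows "Poly_Mapping.single \<alpha> (1::'k::field) - Poly_Mapping.single \<beta> 1 \<in> ideal_generated_by S"
proof -
  define \<gamma> where "\<gamma> = \<alpha> - Poly_Mapping.single 1 (k * c)"
  have "\<alpha> = \<gamma> + Poly_Mapping.single 1 (k * c)" "\<beta> = \<gamma> + Poly_Mapping.single 2 (k * c)"
    unfolding \<gamma>_def using assms(2-)
    by (intro monomial4_eqI; simp add: lookup_add lookup_minus lookup_single when_def)+
  then have "Poly_Mapping.single \<alpha> (1::'k) - Poly_Mapping.single \<beta> 1 =
      Poly_Mapping.single \<gamma> 1 * (X 1 ^ (k * c) - X 2 ^ (k * c))"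
    by (simp add: X_power mult_single right_diff_distrib)
  moreover have "X 1 ^ (k * c) - X 2 ^ (k * c) =
      (\<Sum>i<c. (X 2 ^ k) ^ (c - Suc i) * (X 1 ^ k) ^ i) * (X 1 ^ k - X 2 ^ k :: 'k poly4)"
    by (subst power_mult, subst power_mult, subst power_diff_sumr2) (rule mult.commute)
  ultimately show ?thesis using J by (simp only: ideal_mult)
qed

lemma binomial_nonzero:
  assumes "\<alpha> \<noteq> \<beta>"
  shows "Poly_Mapping.single \<alpha> 1 - Poly_Mapping.single \<beta> 1 \<noteq> (0 :: 'k::field poly4)"
proof
  assume "Poly_Mapping.single \<alpha> 1 - Poly_Mapping.single \<beta> 1 = (0 :: 'k poly4)"
  then have "Poly_Mapping.lookup (Poly_Mapping.single \<alpha> 1 - Poly_Mapping.single \<beta> (1::'k)) \<alpha> = 0"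
    by simp
  with assms show False by (simp add: lookup_minus lookup_single when_def)
qed

section \<open>Multiples of a modulus and bounded remainders\<close>

text \<open>A negative \<open>c\<close> would give \<open>b + c * a \<le> b - a < 0\<close>. This
  forces the signs of lattice coordinates.\<close>

lemma nonneg_factor:
  fixes a b c :: int
  assumes "0 \<le> b + c * a" "b < a" "0 < a"
  shows "0 \<le> c"
proof (rule ccontr)
  assume "\<not> 0 \<le> c"
  then have "c * a \<le> (- 1) * a" using assms(3) by (intro mult_right_mono) auto
  with assms show False by linarith
qed

text \<open>Both \<open>x\<close> and \<open>y\<close> are remainders modulo \<open>a\<close>, so
  the sign argument applies to \<open>c\<close> and to \<open>- c\<close>.\<close>

lemma zero_factor:
  fixes x y a :: nat and c :: int
  assumes "int x - int y = c * int a" "x < a" "y < a"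
  shows "c = 0"
  using nonneg_factor[of "int y" c "int a"] nonneg_factor[of "int x" "- c" "int a"] assms by simp

subsection \<open>The lattice of exponent differences\<close>

text \<open>The exponents stay parameters because the locale is interpreted twice: for the given
  ones and for those shifted by \<open>w\<close>.\<close>

locale triangular_lattice =
  fixes a\<^sub>1 a\<^sub>2 a\<^sub>3 a\<^sub>4 u\<^sub>1 u\<^sub>2 v\<^sub>1 v\<^sub>2 v\<^sub>3 :: nat
  assumes pos: "0 < a\<^sub>1" "0 < a\<^sub>2" "0 < a\<^sub>3" "0 < a\<^sub>4"
begin

text \<open>\<open>c\<^sub>1, c\<^sub>2, c\<^sub>3\<close> are coordinates with respect to the
  exponent vectors of \<open>F\<^sub>1, F\<^sub>2, F\<^sub>3\<close>. The system is triangular: the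
  fourth entry determines \<open>c\<^sub>3\<close>, then the third determines
  \<open>c\<^sub>2\<close>.\<close>

definition in_lattice :: "int \<Rightarrow> int \<Rightarrow> int \<Rightarrow> int \<Rightarrow> bool"
  where "in_lattice z\<^sub>1 z\<^sub>2 z\<^sub>3 z\<^sub>4 \<longleftrightarrow> (\<exists>(c\<^sub>1 :: int) (c\<^sub>2 :: int) (c\<^sub>3 :: int).
    z\<^sub>1 = c\<^sub>1 * a\<^sub>1 - c\<^sub>2 * u\<^sub>1 - c\<^sub>3 * v\<^sub>1 \<and>
    z\<^sub>2 = - c\<^sub>1 * a\<^sub>2 - c\<^sub>2 * u\<^sub>2 - c\<^sub>3 * v\<^sub>2 \<and>
    z\<^sub>3 = c\<^sub>2 * a\<^sub>3 - c\<^sub>3 * v\<^sub>3 \<and>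
    z\<^sub>4 = c\<^sub>3 * a\<^sub>4)"

definition lattice_cong :: "monomial4 \<Rightarrow> monomial4 \<Rightarrow> bool"
  where "lattice_cong \<alpha> \<beta> \<longleftrightarrow> in_lattice
    (int (Poly_Mapping.lookup \<alpha> 1) - int (Poly_Mapping.lookup \<beta> 1))
    (int (Poly_Mapping.lookup \<alpha> 2) - int (Poly_Mapping.lookup \<beta> 2))
    (int (Poly_Mapping.lookup \<alpha> 3) - int (Poly_Mapping.lookup \<beta> 3))
    (int (Poly_Mapping.lookup \<alpha> 4) - int (Poly_Mapping.lookup \<beta> 4))"

definition F\<^sub>1 :: "'k::field poly4"
  where "F\<^sub>1 = X 1 ^ a\<^sub>1 - X 2 ^ a\<^sub>2"

definition F\<^sub>2 :: "'k::field poly4"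
  where "F\<^sub>2 = X 3 ^ a\<^sub>3 - X 1 ^ u\<^sub>1 * X 2 ^ u\<^sub>2"

definition F\<^sub>3 :: "'k::field poly4"
  where "F\<^sub>3 = X 4 ^ a\<^sub>4 - X 1 ^ v\<^sub>1 * X 2 ^ v\<^sub>2 * X 3 ^ v\<^sub>3"

text \<open>The maximal minors of the lattice basis, up to sign.\<close>

definition minors :: "4 \<Rightarrow> nat"
  where "minors i =
    (if i = 1 then a\<^sub>2 * a\<^sub>3 * a\<^sub>4
     else if i = 2 then a\<^sub>1 * a\<^sub>3 * a\<^sub>4
     else if i = 3 then a\<^sub>4 * (u\<^sub>1 * a\<^sub>2 + u\<^sub>2 * a\<^sub>1)
     else a\<^sub>3 * (v\<^sub>1 * a\<^sub>2 + v\<^sub>2 * a\<^sub>1) + v\<^sub>3 * (u\<^sub>1 * a\<^sub>2 + u\<^sub>2 * a\<^sub>1))"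

lemma minors_simps:
  "minors 1 = a\<^sub>2 * a\<^sub>3 * a\<^sub>4" "minors 2 = a\<^sub>1 * a\<^sub>3 * a\<^sub>4"
  "minors 3 = a\<^sub>4 * (u\<^sub>1 * a\<^sub>2 + u\<^sub>2 * a\<^sub>1)"
  "minors 4 = a\<^sub>3 * (v\<^sub>1 * a\<^sub>2 + v\<^sub>2 * a\<^sub>1) + v\<^sub>3 * (u\<^sub>1 * a\<^sub>2 + u\<^sub>2 * a\<^sub>1)"
  by (simp_all add: minors_def)

lemma F_binomials:
  "F\<^sub>1 = (Poly_Mapping.single (Poly_Mapping.single 1 a\<^sub>1) 1 -
    Poly_Mapping.single (Poly_Mapping.single 2 a\<^sub>2) 1 :: 'k::field poly4)"
  "F\<^sub>2 = (Poly_Mapping.single (Poly_Mapping.single 3 a\<^sub>3) 1 -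
    Poly_Mapping.single (Poly_Mapping.single 1 u\<^sub>1 + Poly_Mapping.single 2 u\<^sub>2) 1 :: 'k::field poly4)"
  "F\<^sub>3 = (Poly_Mapping.single (Poly_Mapping.single 4 a\<^sub>4) 1 -
    Poly_Mapping.single (Poly_Mapping.single 1 v\<^sub>1 + Poly_Mapping.single 2 v\<^sub>2 +
      Poly_Mapping.single 3 v\<^sub>3) 1 :: 'k::field poly4)"
  by (simp_all add: F\<^sub>1_def F\<^sub>2_def F\<^sub>3_def X_power mult_single)

lemma in_lattice_basis:
  "in_lattice (int a\<^sub>1) (- int a\<^sub>2) 0 0" "in_lattice (- int u\<^sub>1) (- int u\<^sub>2) (int a\<^sub>3) 0"
  "in_lattice (- int v\<^sub>1) (- int v\<^sub>2) (- int v\<^sub>3) (int a\<^sub>4)"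
  unfolding in_lattice_def
  by (rule exI[of _ 1], rule exI[of _ 0], rule exI[of _ 0], simp)
     (rule exI[of _ 0], rule exI[of _ 1], rule exI[of _ 0], simp,
      rule exI[of _ 0], rule exI[of _ 0], rule exI[of _ 1], simp)

lemma in_lattice_add:
  fixes x\<^sub>1 x\<^sub>2 x\<^sub>3 x\<^sub>4 y\<^sub>1 y\<^sub>2 y\<^sub>3 y\<^sub>4 :: int
  assumes "in_lattice x\<^sub>1 x\<^sub>2 x\<^sub>3 x\<^sub>4" "in_lattice y\<^sub>1 y\<^sub>2 y\<^sub>3 y\<^sub>4"
  shows "in_lattice (x\<^sub>1 + y\<^sub>1) (x\<^sub>2 + y\<^sub>2) (x\<^sub>3 + y\<^sub>3) (x\<^sub>4 + y\<^sub>4)"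
proof -
  from assms obtain c\<^sub>1 c\<^sub>2 c\<^sub>3 d\<^sub>1 d\<^sub>2 d\<^sub>3 :: int where
    "x\<^sub>1 = c\<^sub>1 * a\<^sub>1 - c\<^sub>2 * u\<^sub>1 - c\<^sub>3 * v\<^sub>1" "x\<^sub>2 = - c\<^sub>1 * a\<^sub>2 - c\<^sub>2 * u\<^sub>2 - c\<^sub>3 * v\<^sub>2"
    "x\<^sub>3 = c\<^sub>2 * a\<^sub>3 - c\<^sub>3 * v\<^sub>3" "x\<^sub>4 = c\<^sub>3 * a\<^sub>4"
    "y\<^sub>1 = d\<^sub>1 * a\<^sub>1 - d\<^sub>2 * u\<^sub>1 - d\<^sub>3 * v\<^sub>1" "y\<^sub>2 = - d\<^sub>1 * a\<^sub>2 - d\<^sub>2 * u\<^sub>2 - d\<^sub>3 * v\<^sub>2"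
    "y\<^sub>3 = d\<^sub>2 * a\<^sub>3 - d\<^sub>3 * v\<^sub>3" "y\<^sub>4 = d\<^sub>3 * a\<^sub>4"
    unfolding in_lattice_def by blast
  then show ?thesis
    unfolding in_lattice_def
    by (intro exI[of _ "c\<^sub>1 + d\<^sub>1"] exI[of _ "c\<^sub>2 + d\<^sub>2"] exI[of _ "c\<^sub>3 + d\<^sub>3"])
       (simp add: algebra_simps)
qed

lemma in_lattice_uminus:
  fixes x\<^sub>1 x\<^sub>2 x\<^sub>3 x\<^sub>4 :: int
  assumes "in_lattice x\<^sub>1 x\<^sub>2 x\<^sub>3 x\<^sub>4"
  shows "in_lattice (- x\<^sub>1) (- x\<^sub>2) (- x\<^sub>3) (- x\<^sub>4)"
proof -
  from assms obtain c\<^sub>1 c\<^sub>2 c\<^sub>3 :: int where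
    "x\<^sub>1 = c\<^sub>1 * a\<^sub>1 - c\<^sub>2 * u\<^sub>1 - c\<^sub>3 * v\<^sub>1" "x\<^sub>2 = - c\<^sub>1 * a\<^sub>2 - c\<^sub>2 * u\<^sub>2 - c\<^sub>3 * v\<^sub>2"
    "x\<^sub>3 = c\<^sub>2 * a\<^sub>3 - c\<^sub>3 * v\<^sub>3" "x\<^sub>4 = c\<^sub>3 * a\<^sub>4"
    unfolding in_lattice_def by blast
  then show ?thesis
    unfolding in_lattice_def
    by (intro exI[of _ "- c\<^sub>1"] exI[of _ "- c\<^sub>2"] exI[of _ "- c\<^sub>3"]) (simp add: algebra_simps)
qed

text \<open>The polynomial ring modulo the three binomials is graded by the quotient of \<open>\<int>\<^sup>4\<close> by the
  lattice, so summing coefficients over a congruence class kills the ideal.\<close>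

lemma lattice_cong_if_in_ideal:
  assumes "Poly_Mapping.single \<alpha> 1 - Poly_Mapping.single \<beta> 1 \<in>
    ideal_generated_by {F\<^sub>1, F\<^sub>2, F\<^sub>3 :: 'k::field poly4}"
  shows "lattice_cong \<alpha> \<beta>"
proof -
  have refl: "lattice_cong \<alpha> \<alpha>"
    unfolding lattice_cong_def in_lattice_def by (intro exI[of _ 0]) simp
  have "class_sum {\<gamma>. lattice_cong \<alpha> \<gamma>}
    (Poly_Mapping.single \<alpha> 1 - Poly_Mapping.single \<beta> (1::'k)) = 0"
  proof (rule class_sum_ideal[OF _ _ _ _ assms])
    show "lattice_cong \<delta> \<gamma>" if "lattice_cong \<gamma> \<delta>" for \<gamma> \<delta>
      using in_lattice_uminus[OF that[unfolded lattice_cong_def]] by (simp add: lattice_cong_def)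
    show "lattice_cong \<gamma> \<epsilon>" if "lattice_cong \<gamma> \<delta>" "lattice_cong \<delta> \<epsilon>" for \<gamma> \<delta> \<epsilon>
      using in_lattice_add[OF that[unfolded lattice_cong_def]] by (simp add: lattice_cong_def)
    show "lattice_cong (\<epsilon> + \<gamma>) (\<epsilon> + \<delta>)" if "lattice_cong \<gamma> \<delta>" for \<gamma> \<delta> \<epsilon>
      using that by (simp add: lattice_cong_def lookup_add)
    fix s :: "'k poly4"
    assume "s \<in> {F\<^sub>1, F\<^sub>2, F\<^sub>3}"
    then consider "s = F\<^sub>1" | "s = F\<^sub>2" | "s = F\<^sub>3" by blast
    then show "\<exists>\<gamma> \<delta>. lattice_cong \<gamma> \<delta> \<and> s = Poly_Mapping.single \<gamma> 1 - Poly_Mapping.single \<delta> 1"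
      using in_lattice_basis
      by cases (force simp: F_binomials lattice_cong_def lookup_add lookup_single when_def)+
  qed
  \<comment> \<open>The class contains \<alpha>, so the sum vanishes only if the term of \<beta>
    cancels it, that is, if \<beta> lies in the class.\<close>
  then show ?thesis
    using refl by (simp add: class_sum_diff class_sum_single split: if_splits)
qed

section \<open>The maximal minors and the orthogonal lattice\<close>

text \<open>The relations make \<open>n\<close> proportional to \<open>minors\<close>, and
  coprimality of \<open>n\<close> makes the factor from \<open>n\<close> to \<open>minors\<close>
  integral. Counting residues modulo \<open>n 1\<close>, with injectivity from
  \<open>kernel\<close>, shows that it is 1.\<close>

lemma eq_minors:
  fixes n :: "4 \<Rightarrow> nat"
  assumes n_pos: "0 < n 1" and n_coprime: "Gcd (range n) = 1"
    and rel: "a\<^sub>1 * n 1 = a\<^sub>2 * n 2" "a\<^sub>3 * n 3 = u\<^sub>1 * n 1 + u\<^sub>2 * n 2"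
      "a\<^sub>4 * n 4 = v\<^sub>1 * n 1 + v\<^sub>2 * n 2 + v\<^sub>3 * n 3"
    and kernel: "\<And>(z\<^sub>1 :: int) (z\<^sub>2 :: int) (z\<^sub>3 :: int) (z\<^sub>4 :: int). z\<^sub>1 * n 1 + z\<^sub>2 * n 2 + z\<^sub>3 * n 3 + z\<^sub>4 * n 4 = 0 \<Longrightarrow>
      in_lattice z\<^sub>1 z\<^sub>2 z\<^sub>3 z\<^sub>4"
  shows "n = minors"
proof -
  have proportional: "n 1 * minors i = minors 1 * n i" for i
  proof -
    have "i \<in> {1, 2, 3, 4}" using UNIV_4 by blast
    moreover have "n 1 * minors 2 = minors 1 * n 2"
      unfolding minors_simps using rel by algebra
    moreover have "n 1 * minors 3 = minors 1 * n 3"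
      unfolding minors_simps using rel by algebra
    moreover have "n 1 * minors 4 = minors 1 * n 4"
      unfolding minors_simps using rel by algebra
    ultimately show ?thesis by auto
  qed
  \<comment> \<open>By proportionality \<open>n 1\<close> divides every
    \<open>minors 1 * n i\<close>, hence also their gcd, which is \<open>minors 1\<close>.\<close>
  have "n 1 dvd Gcd ((*) (minors 1) ` range n)"
    by (rule Gcd_greatest) (auto simp flip: proportional)
  then have "n 1 dvd minors 1"
    using n_coprime by (simp add: Gcd_mult)
  moreover have "minors 1 \<le> n 1"
  proof -
    \<comment> \<open>Modulo the lattice and the first unit vector, distinct box elements are incongruent.\<close>
    let ?box = "{..<a\<^sub>2} \<times> {..<a\<^sub>3} \<times> {..<a\<^sub>4}"
    let ?g = "\<lambda>(i, j, k). (i * n 2 + j * n 3 + k * n 4) mod n 1"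
    have "inj_on ?g ?box"
    proof (rule inj_onI)
      fix x y
      assume "x \<in> ?box" "y \<in> ?box" and g: "?g x = ?g y"
      then obtain i j k i' j' k' where xy: "x = (i, j, k)" "y = (i', j', k')"
        and lt: "i < a\<^sub>2" "j < a\<^sub>3" "k < a\<^sub>4" "i' < a\<^sub>2" "j' < a\<^sub>3" "k' < a\<^sub>4"
        by (cases x, cases y) auto
      have eq: "(i * n 2 + j * n 3 + k * n 4) mod n 1 = (i' * n 2 + j' * n 3 + k' * n 4) mod n 1"
        using g by (simp add: xy)
      from eq have "int (i * n 2 + j * n 3 + k * n 4) mod int (n 1) =
          int (i' * n 2 + j' * n 3 + k' * n 4) mod int (n 1)"
        by (simp only: flip: zmod_int)
      then obtain s where
        s: "int (i * n 2 + j * n 3 + k * n 4) - int (i' * n 2 + j' * n 3 + k' * n 4) = int (n 1) * s"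
        unfolding mod_eq_dvd_iff by (rule dvdE)
      \<comment> \<open>The first entry \<open>- s\<close> is chosen to make the vector orthogonal
        to \<open>n\<close>; the box bounds the other three.\<close>
      have "in_lattice (- s) (int i - int i') (int j - int j') (int k - int k')"
        by (rule kernel) (use s in \<open>simp add: algebra_simps\<close>)
      then obtain c\<^sub>1 c\<^sub>2 c\<^sub>3 :: int where
        c: "int i - int i' = - c\<^sub>1 * a\<^sub>2 - c\<^sub>2 * u\<^sub>2 - c\<^sub>3 * v\<^sub>2"
          "int j - int j' = c\<^sub>2 * a\<^sub>3 - c\<^sub>3 * v\<^sub>3" "int k - int k' = c\<^sub>3 * a\<^sub>4"
        unfolding in_lattice_def by blast
      have "c\<^sub>3 = 0" using zero_factor[OF c(3)] lt by simp
      moreover from this have "c\<^sub>2 = 0" using zero_factor[of j j' c\<^sub>2 a\<^sub>3] c lt by simp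
      moreover from calculation have "- c\<^sub>1 = 0" using zero_factor[of i i' "- c\<^sub>1" a\<^sub>2] c lt by simp
      ultimately show "x = y" using c by (simp add: xy)
    qed
    \<comment> \<open>Pigeonhole: the box has \<open>minors 1\<close> elements, and
      \<open>?g\<close> takes values below \<open>n 1\<close>.\<close>
    then have "card ?box \<le> card {..<n 1}"
      using n_pos by (intro card_inj_on_le) auto
    then show ?thesis by (simp add: minors_simps card_cartesian_product)
  qed
  moreover have "0 < minors 1" using pos by (simp add: minors_simps)
  ultimately have "n 1 = minors 1" by (simp add: dvd_imp_le le_antisym)
  with proportional n_pos show ?thesis by (intro ext) (metis mult_cancel1 less_numeral_extra(3))
qed

text \<open>Coprime minors make the lattice saturated. The coordinates are found by back
  substitution, each divisibility coming from a coprime pair.\<close>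

lemma in_lattice_if_orthogonal:
  fixes z\<^sub>1 z\<^sub>2 z\<^sub>3 z\<^sub>4 :: int
  assumes coprime: "Gcd (range minors) = 1"
    and orth: "z\<^sub>1 * minors 1 + z\<^sub>2 * minors 2 + z\<^sub>3 * minors 3 + z\<^sub>4 * minors 4 = 0"
  shows "in_lattice z\<^sub>1 z\<^sub>2 z\<^sub>3 z\<^sub>4"
proof -
  have one: "p = 1" if "p dvd minors 1" "p dvd minors 2" "p dvd minors 3" "p dvd minors 4" for p
  proof -
    have "p dvd Gcd (range minors)"
    proof (rule Gcd_greatest)
      fix x assume "x \<in> range minors"
      then obtain i where i: "x = minors i" by blast
      have "i \<in> {1, 2, 3, 4}" using UNIV_4 by blast
      with i that show "p dvd x" by auto
    qed
    then show ?thesis using coprime by simp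
  qed
  define U where "U = u\<^sub>1 * a\<^sub>2 + u\<^sub>2 * a\<^sub>1"
  define V where "V = v\<^sub>1 * a\<^sub>2 + v\<^sub>2 * a\<^sub>1"
  have m: "minors 1 = a\<^sub>2 * a\<^sub>3 * a\<^sub>4" "minors 2 = a\<^sub>1 * a\<^sub>3 * a\<^sub>4" "minors 3 = a\<^sub>4 * U"
    "minors 4 = a\<^sub>3 * V + v\<^sub>3 * U"
    by (simp_all add: minors_simps U_def V_def)
  \<comment> \<open>In each of the three pairs below, a common divisor divides all four
    minors.\<close>
  have "coprime a\<^sub>1 a\<^sub>2"
    unfolding coprime_iff_gcd_eq_1
    by (rule one) (auto simp: m U_def V_def intro!: dvd_add dvd_mult dvd_mult2)
  then have cop\<^sub>1: "coprime (int a\<^sub>1) (int a\<^sub>2)" by simp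
  have "coprime a\<^sub>3 U"
    unfolding coprime_iff_gcd_eq_1
    by (rule one) (auto simp: m intro!: dvd_add dvd_mult dvd_mult2)
  then have cop\<^sub>3: "coprime (int a\<^sub>3) (int U)" by simp
  have "coprime a\<^sub>4 (a\<^sub>3 * V + v\<^sub>3 * U)"
    unfolding coprime_iff_gcd_eq_1
    by (rule one) (auto simp: m intro!: dvd_mult dvd_mult2)
  then have cop\<^sub>4: "coprime (int a\<^sub>4) (int (a\<^sub>3 * V + v\<^sub>3 * U))" by (simp only: coprime_int_iff)
  \<comment> \<open>Every term of \<open>orth\<close> except the last carries the factor
    \<open>a\<^sub>4\<close>. After cancelling it, the same argument is repeated with
    \<open>a\<^sub>3\<close> and then \<open>a\<^sub>1\<close>.\<close>
  have "z\<^sub>4 * int (a\<^sub>3 * V + v\<^sub>3 * U) = int a\<^sub>4 * (- (z\<^sub>1 * a\<^sub>2 * a\<^sub>3 + z\<^sub>2 * a\<^sub>1 * a\<^sub>3 + z\<^sub>3 * U))"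
    using orth by (simp add: m algebra_simps)
  then have "int a\<^sub>4 dvd z\<^sub>4 * int (a\<^sub>3 * V + v\<^sub>3 * U)" by simp
  then have "int a\<^sub>4 dvd z\<^sub>4"
    using cop\<^sub>4 by (simp only: coprime_dvd_mult_left_iff)
  then obtain c\<^sub>3 :: int where z\<^sub>4: "z\<^sub>4 = int a\<^sub>4 * c\<^sub>3" by (rule dvdE)
  have "int a\<^sub>4 * (z\<^sub>1 * a\<^sub>2 * a\<^sub>3 + z\<^sub>2 * a\<^sub>1 * a\<^sub>3 + z\<^sub>3 * U + c\<^sub>3 * (a\<^sub>3 * V + v\<^sub>3 * U)) = 0"
    using orth by (simp add: m z\<^sub>4 algebra_simps)
  then have orth\<^sub>3: "z\<^sub>1 * a\<^sub>2 * a\<^sub>3 + z\<^sub>2 * a\<^sub>1 * a\<^sub>3 + z\<^sub>3 * U + c\<^sub>3 * (a\<^sub>3 * V + v\<^sub>3 * U) = 0"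
    using pos by simp
  then have "(z\<^sub>3 + c\<^sub>3 * v\<^sub>3) * int U = int a\<^sub>3 * (- (z\<^sub>1 * a\<^sub>2 + z\<^sub>2 * a\<^sub>1 + c\<^sub>3 * V))"
    by (simp add: algebra_simps)
  then have "int a\<^sub>3 dvd (z\<^sub>3 + c\<^sub>3 * v\<^sub>3) * int U" by simp
  then have "int a\<^sub>3 dvd z\<^sub>3 + c\<^sub>3 * v\<^sub>3"
    using cop\<^sub>3 by (simp only: coprime_dvd_mult_left_iff)
  then obtain c\<^sub>2 :: int where c\<^sub>2: "z\<^sub>3 + c\<^sub>3 * v\<^sub>3 = int a\<^sub>3 * c\<^sub>2" by (rule dvdE)
  then have z\<^sub>3: "z\<^sub>3 = int a\<^sub>3 * c\<^sub>2 - c\<^sub>3 * v\<^sub>3" by simp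
  have "int a\<^sub>3 * (z\<^sub>1 * a\<^sub>2 + z\<^sub>2 * a\<^sub>1 + c\<^sub>2 * U + c\<^sub>3 * V) = 0"
    using orth\<^sub>3 by (simp add: z\<^sub>3 algebra_simps)
  then have "z\<^sub>1 * a\<^sub>2 + z\<^sub>2 * a\<^sub>1 + c\<^sub>2 * U + c\<^sub>3 * V = 0"
    using pos by simp
  then have orth\<^sub>1: "(z\<^sub>1 + c\<^sub>2 * u\<^sub>1 + c\<^sub>3 * v\<^sub>1) * int a\<^sub>2 = int a\<^sub>1 * (- (z\<^sub>2 + c\<^sub>2 * u\<^sub>2 + c\<^sub>3 * v\<^sub>2))"
    by (simp add: U_def V_def algebra_simps)
  then have "int a\<^sub>1 dvd (z\<^sub>1 + c\<^sub>2 * u\<^sub>1 + c\<^sub>3 * v\<^sub>1) * int a\<^sub>2" by simp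
  then have "int a\<^sub>1 dvd z\<^sub>1 + c\<^sub>2 * u\<^sub>1 + c\<^sub>3 * v\<^sub>1"
    using cop\<^sub>1 by (simp only: coprime_dvd_mult_left_iff)
  then obtain c\<^sub>1 :: int where c\<^sub>1: "z\<^sub>1 + c\<^sub>2 * u\<^sub>1 + c\<^sub>3 * v\<^sub>1 = int a\<^sub>1 * c\<^sub>1" by (rule dvdE)
  have "int a\<^sub>1 * (z\<^sub>2 + c\<^sub>2 * u\<^sub>2 + c\<^sub>3 * v\<^sub>2) = int a\<^sub>1 * (- c\<^sub>1 * a\<^sub>2)"
    using orth\<^sub>1 unfolding c\<^sub>1 by (simp add: algebra_simps)
  then have "z\<^sub>2 + c\<^sub>2 * u\<^sub>2 + c\<^sub>3 * v\<^sub>2 = - c\<^sub>1 * a\<^sub>2"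
    using pos by (simp only: mult_cancel_left) simp
  with c\<^sub>1 z\<^sub>3 z\<^sub>4 show ?thesis
    unfolding in_lattice_def
    by (intro exI[of _ c\<^sub>1] exI[of _ c\<^sub>2] exI[of _ c\<^sub>3]) (simp add: algebra_simps)
qed

section \<open>The initial ideal of the toric ideal of the minors\<close>

text \<open>If \<open>\<beta>\<close> is not divisible by the leading monomials, the coordinates of \<open>\<alpha> - \<beta>\<close> in the lattice basis
  are, from the last to the first, of a sign forced by \<open>\<alpha> \<ge> 0\<close>; each then lowers the total degree.\<close>

lemma initial_ideal_complete_intersection:
  assumes coprime: "Gcd (range minors) = 1"
    and deg: "a\<^sub>3 < u\<^sub>1 + u\<^sub>2" "a\<^sub>4 < v\<^sub>1 + v\<^sub>2 + v\<^sub>3"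
  shows "complete_intersection3 (initial_ideal (toric_ideal minors :: 'k::field poly4 set))"
proof -
  let ?S = "{initial_form F\<^sub>1, initial_form F\<^sub>2, initial_form F\<^sub>3 :: 'k poly4}"
  define J where "J = ideal_generated_by ?S"
  have J: "initial_form F\<^sub>1 \<in> J" "initial_form F\<^sub>2 \<in> J" "initial_form F\<^sub>3 \<in> J"
    unfolding J_def by (auto intro: ideal_base)
  have ne: "Poly_Mapping.single 1 a\<^sub>1 \<noteq> (Poly_Mapping.single 2 a\<^sub>2 :: monomial4)"
    "Poly_Mapping.single 3 a\<^sub>3 \<noteq> (Poly_Mapping.single 1 u\<^sub>1 + Poly_Mapping.single 2 u\<^sub>2 :: monomial4)"
    "Poly_Mapping.single 4 a\<^sub>4 \<noteq> (Poly_Mapping.single 1 v\<^sub>1 + Poly_Mapping.single 2 v\<^sub>2 +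
      Poly_Mapping.single 3 v\<^sub>3 :: monomial4)"
    using pos
    by (auto dest!: arg_cong[where f = "\<lambda>p. (Poly_Mapping.lookup p 1, Poly_Mapping.lookup p 3, Poly_Mapping.lookup p 4)"]
      simp: lookup_add lookup_single when_def)
  note init = initial_form_binomial[OF ne(1), where 'k = 'k, folded F_binomials]
    initial_form_binomial(1)[OF ne(2), where 'k = 'k, folded F_binomials]
    initial_form_binomial(1)[OF ne(3), where 'k = 'k, folded F_binomials]
  note td = total_degree_4 lookup_add lookup_single when_def
  \<comment> \<open>By \<open>deg\<close> the pure powers have strictly lower degree than the other
    monomials of \<open>F\<^sub>2\<close> and \<open>F\<^sub>3\<close>.\<close>
  have J\<^sub>3: "X 3 ^ a\<^sub>3 \<in> J" and J\<^sub>4: "X 4 ^ a\<^sub>4 \<in> J"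
    using J(2,3) deg by (simp_all add: init td X_power)
  have J\<^sub>1: "X 1 ^ a\<^sub>1 \<in> J" if "a\<^sub>1 < a\<^sub>2"
    using J(1) that by (simp add: init td X_power)
  have J\<^sub>2: "X 2 ^ a\<^sub>2 \<in> J" if "a\<^sub>2 < a\<^sub>1"
    using ideal_minus[OF J(1)[unfolded J_def], folded J_def] that by (simp add: init td X_power)
  have J\<^sub>0: "X 1 ^ a\<^sub>1 - X 2 ^ a\<^sub>2 \<in> J" if "a\<^sub>1 = a\<^sub>2"
  proof -
    have "initial_form F\<^sub>1 = (F\<^sub>1 :: 'k poly4)"
      using that by (intro init(2)) (simp add: td)
    then show ?thesis using J(1) by (simp only: F\<^sub>1_def)
  qed
  have std: "total_degree \<alpha> < total_degree \<beta> \<or>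
      total_degree \<alpha> = total_degree \<beta> \<and> Poly_Mapping.single \<alpha> 1 - Poly_Mapping.single \<beta> 1 \<in> J"
    if \<beta>: "Poly_Mapping.single \<beta> 1 \<notin> J" and w: "weight minors \<alpha> = weight minors \<beta>" for \<alpha> \<beta>
  proof -
    let ?\<alpha> = "\<lambda>i. int (Poly_Mapping.lookup \<alpha> i)" and ?\<beta> = "\<lambda>i. int (Poly_Mapping.lookup \<beta> i)"
    note in_J = monomial_in_ideal[where S = ?S, folded J_def]
    \<comment> \<open>A monomial outside \<open>J\<close> is divisible by no pure power in
      \<open>J\<close>. For \<open>a\<^sub>1 = a\<^sub>2\<close> the first two exponents get no
      bound, because the initial form of \<open>F\<^sub>1\<close> is then the whole
      binomial.\<close>
    have \<beta>\<^sub>3: "?\<beta> 3 < a\<^sub>3" and \<beta>\<^sub>4: "?\<beta> 4 < a\<^sub>4"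
      and \<beta>\<^sub>1: "a\<^sub>1 < a\<^sub>2 \<Longrightarrow> ?\<beta> 1 < a\<^sub>1" and \<beta>\<^sub>2: "a\<^sub>2 < a\<^sub>1 \<Longrightarrow> ?\<beta> 2 < a\<^sub>2"
      using in_J[OF J\<^sub>3] in_J[OF J\<^sub>4] in_J[OF J\<^sub>1] in_J[OF J\<^sub>2] \<beta> by (meson not_le of_nat_less_iff)+
    have "in_lattice (?\<alpha> 1 - ?\<beta> 1) (?\<alpha> 2 - ?\<beta> 2) (?\<alpha> 3 - ?\<beta> 3) (?\<alpha> 4 - ?\<beta> 4)"
    proof (rule in_lattice_if_orthogonal[OF coprime])
      have "int (weight minors \<alpha>) = int (weight minors \<beta>)" using w by simp
      then show "(?\<alpha> 1 - ?\<beta> 1) * minors 1 + (?\<alpha> 2 - ?\<beta> 2) * minors 2 +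
          (?\<alpha> 3 - ?\<beta> 3) * minors 3 + (?\<alpha> 4 - ?\<beta> 4) * minors 4 = 0"
        unfolding weight_4 by (simp add: left_diff_distrib)
    qed
    then obtain c\<^sub>1 c\<^sub>2 c\<^sub>3 :: int where
      c: "?\<alpha> 1 - ?\<beta> 1 = c\<^sub>1 * a\<^sub>1 - c\<^sub>2 * u\<^sub>1 - c\<^sub>3 * v\<^sub>1"
        "?\<alpha> 2 - ?\<beta> 2 = - c\<^sub>1 * a\<^sub>2 - c\<^sub>2 * u\<^sub>2 - c\<^sub>3 * v\<^sub>2"
        "?\<alpha> 3 - ?\<beta> 3 = c\<^sub>2 * a\<^sub>3 - c\<^sub>3 * v\<^sub>3" "?\<alpha> 4 - ?\<beta> 4 = c\<^sub>3 * a\<^sub>4"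
      unfolding in_lattice_def by blast
    have \<alpha>0: "0 \<le> ?\<alpha> i" for i by simp
    have c\<^sub>3: "0 \<le> c\<^sub>3"
      using nonneg_factor[of "?\<beta> 4" c\<^sub>3 a\<^sub>4] c(4) \<alpha>0[of 4] \<beta>\<^sub>4 pos by linarith
    then have "0 \<le> c\<^sub>3 * v\<^sub>1" "0 \<le> c\<^sub>3 * v\<^sub>2" "0 \<le> c\<^sub>3 * v\<^sub>3" by simp_all
    note c\<^sub>3' = this
    have c\<^sub>2: "0 \<le> c\<^sub>2"
      using nonneg_factor[of "?\<beta> 3" c\<^sub>2 a\<^sub>3] c(3) \<alpha>0[of 3] \<beta>\<^sub>3 pos c\<^sub>3' by linarith
    then have "0 \<le> c\<^sub>2 * u\<^sub>1" "0 \<le> c\<^sub>2 * u\<^sub>2" by simp_all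
    note c\<^sub>2' = this
    \<comment> \<open>For \<open>a\<^sub>1 < a\<^sub>2\<close> the first entry forces
      \<open>c\<^sub>1\<close> to be nonnegative, for \<open>a\<^sub>1 > a\<^sub>2\<close> the
      second forces it to be nonpositive; in both cases the degree cannot rise.\<close>
    have c\<^sub>1: "c\<^sub>1 * (int a\<^sub>1 - int a\<^sub>2) \<le> 0"
    proof (cases a\<^sub>1 a\<^sub>2 rule: linorder_cases)
      case less
      then have "0 \<le> c\<^sub>1"
        using nonneg_factor[of "?\<beta> 1" c\<^sub>1 a\<^sub>1] c(1) \<alpha>0[of 1] \<beta>\<^sub>1 pos c\<^sub>2' c\<^sub>3' by linarith
      with less show ?thesis by (simp add: mult_nonneg_nonpos)
    next
      case greater
      then have "0 \<le> - c\<^sub>1"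
        using nonneg_factor[of "?\<beta> 2" "- c\<^sub>1" a\<^sub>2] c(2) \<alpha>0[of 2] \<beta>\<^sub>2 pos c\<^sub>2' c\<^sub>3' by linarith
      with greater show ?thesis by (simp add: mult_nonpos_nonneg)
    qed simp
    have diff: "int (total_degree \<alpha>) - int (total_degree \<beta>) = c\<^sub>1 * (int a\<^sub>1 - int a\<^sub>2) -
        c\<^sub>2 * (int (u\<^sub>1 + u\<^sub>2) - int a\<^sub>3) - c\<^sub>3 * (int (v\<^sub>1 + v\<^sub>2 + v\<^sub>3) - int a\<^sub>4)"
      using c unfolding total_degree_4 by (simp add: algebra_simps)
    \<comment> \<open>The gaps in \<open>deg\<close> are at least 1, so equal degrees leave no room
      for a positive \<open>c\<^sub>2\<close> or \<open>c\<^sub>3\<close>.\<close>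
    have le: "c\<^sub>2 \<le> c\<^sub>2 * (int (u\<^sub>1 + u\<^sub>2) - int a\<^sub>3)"
      "c\<^sub>3 \<le> c\<^sub>3 * (int (v\<^sub>1 + v\<^sub>2 + v\<^sub>3) - int a\<^sub>4)"
      using deg c\<^sub>2 c\<^sub>3 mult_left_mono[of 1 "int (u\<^sub>1 + u\<^sub>2) - int a\<^sub>3" c\<^sub>2]
        mult_left_mono[of 1 "int (v\<^sub>1 + v\<^sub>2 + v\<^sub>3) - int a\<^sub>4" c\<^sub>3] by simp_all
    show ?thesis
    proof (cases "total_degree \<alpha> < total_degree \<beta>")
      case False
      then have z: "c\<^sub>2 = 0" "c\<^sub>3 = 0" "c\<^sub>1 * (int a\<^sub>1 - int a\<^sub>2) = 0"
        using diff le c\<^sub>1 c\<^sub>2 c\<^sub>3 by linarith+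
      then have deg_eq: "total_degree \<alpha> = total_degree \<beta>" using diff by auto
      have "Poly_Mapping.single \<alpha> 1 - Poly_Mapping.single \<beta> 1 \<in> J"
      proof (cases "c\<^sub>1 = 0")
        case True
        then have "\<alpha> = \<beta>" using c z by (intro monomial4_eqI) simp_all
        then show ?thesis by (simp add: J_def ideal_zero)
      next
        case False
        then have eq: "a\<^sub>1 = a\<^sub>2" using z by simp
        note bin = binomial_in_ideal[where S = ?S and k = a\<^sub>1, folded J_def, OF J\<^sub>0[OF eq, folded eq]]
        have c': "?\<alpha> 1 - ?\<beta> 1 = c\<^sub>1 * a\<^sub>1" "?\<alpha> 2 - ?\<beta> 2 = - c\<^sub>1 * a\<^sub>1"
          and c'': "Poly_Mapping.lookup \<alpha> 3 = Poly_Mapping.lookup \<beta> 3"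
            "Poly_Mapping.lookup \<alpha> 4 = Poly_Mapping.lookup \<beta> 4"
          using c z eq by simp_all
        \<comment> \<open>\<open>binomial_in_ideal\<close> takes a natural multiplier; for negative
          \<open>c\<^sub>1\<close> the roles of \<alpha> and \<beta> are exchanged.\<close>
        obtain k where "c\<^sub>1 = int k \<or> c\<^sub>1 = - int k"
          using int_cases2[of c\<^sub>1] by metis
        then show ?thesis
        proof
          assume "c\<^sub>1 = int k"
          then have "?\<alpha> 1 = ?\<beta> 1 + int a\<^sub>1 * int k" "?\<beta> 2 = ?\<alpha> 2 + int a\<^sub>1 * int k"
            using c' by (simp_all add: algebra_simps)
          then show ?thesis
            using c'' by (intro bin) (simp_all only: of_nat_eq_iff flip: of_nat_add of_nat_mult)
        next
          assume "c\<^sub>1 = - int k"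
          then have "?\<beta> 1 = ?\<alpha> 1 + int a\<^sub>1 * int k" "?\<alpha> 2 = ?\<beta> 2 + int a\<^sub>1 * int k"
            using c' by (simp_all add: algebra_simps)
          then have "Poly_Mapping.single \<beta> 1 - Poly_Mapping.single \<alpha> 1 \<in> J"
            using c'' by (intro bin) (simp_all only: of_nat_eq_iff flip: of_nat_add of_nat_mult)
          then show ?thesis
            unfolding J_def by (subst minus_diff_eq[symmetric]) (rule ideal_minus)
        qed
      qed
      with deg_eq show ?thesis by simp
    qed simp
  qed
  have F_toric: "F\<^sub>1 \<in> toric_ideal minors" "F\<^sub>2 \<in> toric_ideal minors" "F\<^sub>3 \<in> toric_ideal minors"
    unfolding F_binomials binomial_in_toric_ideal weight_4
    by (simp_all add: minors_simps lookup_add lookup_single when_def algebra_simps)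
  have F_nonzero: "F\<^sub>1 \<noteq> (0 :: 'k poly4)" "F\<^sub>2 \<noteq> (0 :: 'k poly4)" "F\<^sub>3 \<noteq> (0 :: 'k poly4)"
    using ne by (simp_all only: F_binomials binomial_nonzero not_False_eq_True)
  have "initial_ideal (toric_ideal minors :: 'k poly4 set) = J"
  proof
    show "initial_ideal (toric_ideal minors) \<subseteq> J"
      unfolding initial_ideal_def J_def
      using initial_form_in_ideal[where S = ?S and m = minors, folded J_def, OF std]
      by (intro ideal_subset) (auto simp: J_def)
    show "J \<subseteq> initial_ideal (toric_ideal minors)"
      unfolding initial_ideal_def J_def
      using F_toric F_nonzero by (intro ideal_subset) (auto intro!: ideal_base)
  qed
  then show ?thesis
    unfolding complete_intersection3_def J_def by blast
qed

end

section \<open>Application to the given sequence and its shifts\<close>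

text \<open>The \<open>LEAST\<close> is taken over a nonempty set: \<open>n j\<close> is such a
  multiple for any other index \<open>j\<close>, since \<open>n j * n i = n i * n j\<close>.\<close>

lemma least_multiple_pos:
  assumes n_pos: "\<forall>i. n i > 0"
  shows "least_multiple n i > 0"
proof -
  let ?P = "\<lambda>a. a > 0 \<and> (\<exists>c :: 4 \<Rightarrow> nat. a * n i = (\<Sum>j\<in>UNIV - {i}. c j * n j))"
  have "i + 1 \<noteq> i" by simp
  then obtain j where j: "j \<noteq> i" ..
  have "(\<Sum>l\<in>UNIV - {i}. (if l = j then n i else 0) * n l) =
      (\<Sum>l\<in>UNIV - {i}. if l = j then n i * n j else 0)"
    by (rule sum.cong) simp_all
  also have "\<dots> = n j * n i"
    using j by (subst sum.delta) (simp_all add: mult.commute)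
  finally have "n j * n i = (\<Sum>l\<in>UNIV - {i}. (if l = j then n i else 0) * n l)" ..
  with n_pos have "?P (n j)"
    by (intro conjI exI[of _ "\<lambda>l. if l = j then n i else 0"]) simp_all
  then have "?P (LEAST a. ?P a)" by (rule LeastI)
  then show ?thesis by (simp only: least_multiple_def)
qed

theorem theorem3p4:
  fixes n a d :: "4 \<Rightarrow> nat"
    and u\<^sub>1 u\<^sub>2 v\<^sub>1 v\<^sub>2 v\<^sub>3 :: nat
    and f\<^sub>1 f\<^sub>2 f\<^sub>3 :: "'k::field poly4"
  assumes n_pos: "\<forall>i. n i > 0"
    and n_coprime: "Gcd (n ` UNIV) = 1"
    and a: "\<forall>i. a i = least_multiple n i"
    and f\<^sub>1: "f\<^sub>1 = X 1 ^ a 1 - X 2 ^ a 2"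
    and f\<^sub>2: "f\<^sub>2 = X 3 ^ a 3 - X 1 ^ u\<^sub>1 * X 2 ^ u\<^sub>2"
    and f\<^sub>3: "f\<^sub>3 = X 4 ^ a 4 - X 1 ^ v\<^sub>1 * X 2 ^ v\<^sub>2 * X 3 ^ v\<^sub>3"
    and ci: "complete_intersection3 (toric_ideal n :: 'k poly4 set)"
    and gens: "toric_ideal n = ideal_generated_by {f\<^sub>1, f\<^sub>2, f\<^sub>3}"
    and d: "d 1 = 0" "d 2 = 0" "d 3 = a 4 * (a 1 + a 2)"
      "d 4 = v\<^sub>3 * (a 1 + a 2) + a 3 * (a 1 + a 2)"
  shows "\<exists>w\<^sub>1 :: nat. \<forall>w \<ge> w\<^sub>1.
    Gcd ((\<lambda>i. n i + w * d i) ` UNIV) = 1 \<longrightarrow>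
    complete_intersection3 (initial_ideal (toric_ideal (\<lambda>i. n i + w * d i) :: 'k poly4 set))"
proof -
  have a_pos: "0 < a i" for i using a n_pos least_multiple_pos by simp
  interpret L: triangular_lattice "a 1" "a 2" "a 3" "a 4" u\<^sub>1 u\<^sub>2 v\<^sub>1 v\<^sub>2 v\<^sub>3
    by unfold_locales (rule a_pos)+
  have toric_eq: "(toric_ideal n :: 'k poly4 set) = ideal_generated_by {L.F\<^sub>1, L.F\<^sub>2, L.F\<^sub>3}"
    by (simp add: gens f\<^sub>1 f\<^sub>2 f\<^sub>3 L.F\<^sub>1_def L.F\<^sub>2_def L.F\<^sub>3_def)
  then have "L.F\<^sub>1 \<in> (toric_ideal n :: 'k poly4 set)" "L.F\<^sub>2 \<in> (toric_ideal n :: 'k poly4 set)"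
    "L.F\<^sub>3 \<in> (toric_ideal n :: 'k poly4 set)"
    by (auto intro: ideal_base)
  then have rel: "a 1 * n 1 = a 2 * n 2" "a 3 * n 3 = u\<^sub>1 * n 1 + u\<^sub>2 * n 2"
    "a 4 * n 4 = v\<^sub>1 * n 1 + v\<^sub>2 * n 2 + v\<^sub>3 * n 3"
    unfolding L.F_binomials binomial_in_toric_ideal weight_4
    by (simp_all add: lookup_add lookup_single when_def)
  have "L.in_lattice z\<^sub>1 z\<^sub>2 z\<^sub>3 z\<^sub>4"
    if z: "z\<^sub>1 * n 1 + z\<^sub>2 * n 2 + z\<^sub>3 * n 3 + z\<^sub>4 * n 4 = 0" for z\<^sub>1 z\<^sub>2 z\<^sub>3 z\<^sub>4 :: int
  proof -
    \<comment> \<open>\<open>nat\<close> truncates negative entries to 0, so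
      \<open>?\<alpha>\<close> and \<open>?\<beta>\<close> are the positive and negative parts of
      the vector, whose difference is the vector itself.\<close>
    define m :: "int \<Rightarrow> int \<Rightarrow> int \<Rightarrow> int \<Rightarrow> monomial4" where
      "m x\<^sub>1 x\<^sub>2 x\<^sub>3 x\<^sub>4 = Poly_Mapping.single 1 (nat x\<^sub>1) + Poly_Mapping.single 2 (nat x\<^sub>2) +
        Poly_Mapping.single 3 (nat x\<^sub>3) + Poly_Mapping.single 4 (nat x\<^sub>4)" for x\<^sub>1 x\<^sub>2 x\<^sub>3 x\<^sub>4
    let ?\<alpha> = "m z\<^sub>1 z\<^sub>2 z\<^sub>3 z\<^sub>4" and ?\<beta> = "m (- z\<^sub>1) (- z\<^sub>2) (- z\<^sub>3) (- z\<^sub>4)"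
    have lookup_m: "Poly_Mapping.lookup (m x\<^sub>1 x\<^sub>2 x\<^sub>3 x\<^sub>4) 1 = nat x\<^sub>1"
      "Poly_Mapping.lookup (m x\<^sub>1 x\<^sub>2 x\<^sub>3 x\<^sub>4) 2 = nat x\<^sub>2"
      "Poly_Mapping.lookup (m x\<^sub>1 x\<^sub>2 x\<^sub>3 x\<^sub>4) 3 = nat x\<^sub>3"
      "Poly_Mapping.lookup (m x\<^sub>1 x\<^sub>2 x\<^sub>3 x\<^sub>4) 4 = nat x\<^sub>4" for x\<^sub>1 x\<^sub>2 x\<^sub>3 x\<^sub>4
      by (simp_all add: m_def lookup_add lookup_single when_def)
    have nat_diff: "int (nat x) - int (nat (- x)) = x" for x by simp
    have nat_diff_mult: "int (nat x) * k - int (nat (- x)) * k = x * k" for x k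
      by (simp only: nat_diff flip: left_diff_distrib)
    have regroup: "p\<^sub>1 + p\<^sub>2 + p\<^sub>3 + p\<^sub>4 - (q\<^sub>1 + q\<^sub>2 + q\<^sub>3 + q\<^sub>4) =
        (p\<^sub>1 - q\<^sub>1) + (p\<^sub>2 - q\<^sub>2) + (p\<^sub>3 - q\<^sub>3) + (p\<^sub>4 - q\<^sub>4)"
      for p\<^sub>1 p\<^sub>2 p\<^sub>3 p\<^sub>4 q\<^sub>1 q\<^sub>2 q\<^sub>3 q\<^sub>4 :: int by simp
    have "int (weight n ?\<alpha>) - int (weight n ?\<beta>) = z\<^sub>1 * n 1 + z\<^sub>2 * n 2 + z\<^sub>3 * n 3 + z\<^sub>4 * n 4"
      unfolding weight_4 lookup_m of_nat_add of_nat_mult regroup nat_diff_mult ..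
    then have "weight n ?\<alpha> = weight n ?\<beta>" using z by simp
    then have "L.lattice_cong ?\<alpha> ?\<beta>"
      by (intro L.lattice_cong_if_in_ideal[where 'k = 'k])
        (simp add: binomial_in_toric_ideal flip: toric_eq)
    then show ?thesis
      by (simp only: L.lattice_cong_def lookup_m nat_diff)
  qed
  then have n: "n = L.minors"
    using n_pos by (intro L.eq_minors[OF _ n_coprime rel]) simp_all
  show ?thesis
  proof (intro exI allI impI)
    fix w :: nat
    \<comment> \<open>The witness for \<open>w\<^sub>1\<close> is \<open>a 3 + a 4\<close>; as both
      are positive, each is strictly below \<open>w\<close>.\<close>
    assume w: "a 3 + a 4 \<le> w" and coprime: "Gcd (range (\<lambda>i. n i + w * d i)) = 1"
    \<comment> \<open>With \<open>v\<^sub>3\<close> left unshifted, adding \<open>w\<close> to the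
      other four exponents raises the third and fourth minors by exactly \<open>w * d 3\<close> and
      \<open>w * d 4\<close> and keeps the first two.\<close>
    interpret W: triangular_lattice "a 1" "a 2" "a 3" "a 4" "u\<^sub>1 + w" "u\<^sub>2 + w" "v\<^sub>1 + w" "v\<^sub>2 + w" v\<^sub>3
      by unfold_locales (rule a_pos)+
    have "n i + w * d i = W.minors i" for i
    proof -
      have "i \<in> {1, 2, 3, 4}" using UNIV_4 by blast
      then show ?thesis
        by (auto simp: n d L.minors_simps W.minors_simps algebra_simps)
    qed
    then have minors: "(\<lambda>i. n i + w * d i) = W.minors" by blast
    have "a 3 < u\<^sub>1 + w + (u\<^sub>2 + w)" "a 4 < v\<^sub>1 + w + (v\<^sub>2 + w) + v\<^sub>3"
      using w a_pos[of 3] a_pos[of 4] by linarith+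
    with coprime show "complete_intersection3
        (initial_ideal (toric_ideal (\<lambda>i. n i + w * d i) :: 'k poly4 set))"
      unfolding minors by (rule W.initial_ideal_complete_intersection)
  qed
qed

end
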